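(* Let $n$ be a power of $2$, let $N_\Omega:\mathbb{C}^n\to\mathbb{C}^n$ be a dense neural network of width $n$, depth $p$ and total rank $K$, and let $\mathcal{X}\subset\mathbb{C}^n$ be a bounded set. Then for every $\epsilon>0$ there exists a diagonal-circulant neural network $N_\Pi$ of width $n$ and of depth at most $5K$ such that $\|N_\Omega(x)-N_\Pi(x)\|_2<\epsilon$ for all $x\in\mathcal{X}$.
   Context: The complex ReLU $\rho:\mathbb{C}^n\to\mathbb{C}^n$ is, coordinatewise, $\rho(z)=\max(0,\mathrm{Re}(z))+\mathbf{i}\max(0,\mathrm{Im}(z))$. A dense neural network of width $n$ and depth $p$ is given by $\Omega=\{(W^{(i)},b^{(i)})\}_{i=1}^p$ with $W^{(i)}\in\mathbb{C}^{n\times n}$, $b^{(i)}\in\mathbb{C}^n$, and is the function $N_\Omega=\phi_{W^{(p)},b^{(p)}}\circ\cdots\circ\phi_{W^{(1)},b^{(1)}}$, where $\phi_{W,b}(x)=\rho(Wx+b)$. Its total rank is $\sum_{i=1}^p\mathrm{rank}(W^{(i)})$. A diagonal-circulant neural network of width $n$ and depth $m$ is a function $N_\Pi=\phi_{D^{(m)}C^{(m)},c^{(m)}}\circ\cdots\circ\phi_{D^{(1)}C^{(1)},c^{(1)}}$, where each $D^{(i)}\in\mathbb{C}^{n\times n}$ is diagonal, each $C^{(i)}\in\mathbb{C}^{n\times n}$ is circulant (i.e. $C_{j,l}=c_{(j-l)\bmod n}$ for some $(c_0,\dots,c_{n-1})\in\mathbb{C}^n$), each $c^{(i)}\in\mathbb{C}^n$,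 and $\phi_{DC,c}(x)=\rho(DCx+c)$.
   Formalization: The total rank K is assumed to be at least 1: for K = 0 the dense network is constant, and no diagonal-circulant network of depth 0 need approximate it (n = 1, W = 0, b = 1, X = {0}, ε = 1/2). *)

theory Defs
  imports
    Complex_Main
    "HOL-Analysis.L2_Norm"
    "Jordan_Normal_Form.DL_Rank"
begin

text \<open>Vectors of \<open>\<complex>\<^sup>n\<close> are elements of \<open>carrier_vec n\<close>, indexed from \<open>0\<close> to \<open>n - 1\<close>.\<close>

definition crelu :: "complex \<Rightarrow> complex" where
  "crelu z = Complex (max 0 (Re z)) (max 0 (Im z))"

definition layer :: "complex mat \<Rightarrow> complex vec \<Rightarrow> complex vec \<Rightarrow> complex vec" where
  "layer W b x = map_vec crelu (W *\<^sub>v x + b)"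

definition l2norm :: "complex vec \<Rightarrow> real" where
  "l2norm v = L2_set (\<lambda>i. cmod (v $ i)) {..<dim_vec v}"

definition bounded_in :: "nat \<Rightarrow> complex vec set \<Rightarrow> bool" where
  "bounded_in n X \<longleftrightarrow> X \<subseteq> carrier_vec n \<and> (\<exists>B. \<forall>x\<in>X. l2norm x \<le> B)"

text \<open>
  A network is the list of its layers in order of application (the head is the layer with
  index 1), so its depth is the length of the list. The indexing of layers by \<open>1, \<dots>, p\<close> is
  read with \<open>p \<ge> 1\<close>: the empty composition does not count as a network.
\<close>

type_synonym dense_net = "(complex mat \<times> complex vec) list"

definition is_dense_net :: "nat \<Rightarrow> dense_net \<Rightarrow> bool" where
  "is_dense_net n \<Omega> \<longleftrightarrow> \<Omega> \<noteq> [] \<and> (\<forall>(W, b) \<in> set \<Omega>. W \<in> carrier_mat n n \<and> b \<in> carrier_vec n)"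

definition dense_fun :: "dense_net \<Rightarrow> complex vec \<Rightarrow> complex vec" where
  "dense_fun \<Omega> = fold (\<lambda>(W, b). layer W b) \<Omega>"

definition total_rank :: "nat \<Rightarrow> dense_net \<Rightarrow> nat" where
  "total_rank n \<Omega> = (\<Sum>(W, b) \<leftarrow> \<Omega>. vec_space.rank n W)"

text \<open>The index difference is taken in \<open>int\<close>, since subtraction on \<open>nat\<close> truncates.\<close>

definition circulant_mat :: "complex mat \<Rightarrow> bool" where
  "circulant_mat A \<longleftrightarrow> square_mat A \<and>
     (\<exists>c \<in> carrier_vec (dim_row A). \<forall>j < dim_row A. \<forall>l < dim_row A.
        A $$ (j, l) = c $ nat ((int j - int l) mod int (dim_row A)))"

type_synonym dc_net = "(complex mat \<times> complex mat \<times> complex vec) list"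

definition is_dc_net :: "nat \<Rightarrow> dc_net \<Rightarrow> bool" where
  "is_dc_net n \<Psi> \<longleftrightarrow> \<Psi> \<noteq> [] \<and>
     (\<forall>(D, C, c) \<in> set \<Psi>.
        D \<in> carrier_mat n n \<and> diagonal_mat D \<and>
        C \<in> carrier_mat n n \<and> circulant_mat C \<and>
        c \<in> carrier_vec n)"

definition dc_fun :: "dc_net \<Rightarrow> complex vec \<Rightarrow> complex vec" where
  "dc_fun \<Psi> = fold (\<lambda>(D, C, c). layer (D * C) c) \<Psi>"

end

theory Submission
  imports Defs "Jordan_Normal_Form.Char_Poly" "HOL-Computational_Algebra.Fundamental_Theorem_Algebra"
begin

text \<open>
  Let \<open>W\<close> have rank \<open>k > 0\<close>, and let \<open>K\<close> be the least power of two with \<open>k \<le> K\<close>; then \<open>K\<close> divides \<open>n\<close>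
  and \<open>K < 2k\<close>. Write \<open>W = L O R\<^sup>T\<close>, where \<open>O\<close> is the circulant matrix with \<open>O\<^sub>j\<^sub>l = 1\<close> iff \<open>j \<equiv> l\<close> modulo \<open>K\<close>,
  and \<open>L\<close>, \<open>R\<close> are polynomials of degree \<open>K - 1\<close> in the cyclic shift with diagonal coefficients. Such a
  polynomial can be perturbed so that, after scaling the shift by some \<open>z \<noteq> 0\<close>, it kills a nowhere
  vanishing vector, and then a linear right factor splits off which is circulant times diagonal. By
  induction a polynomial of degree \<open>m\<close> is a limit of alternating products of diagonal and circulant
  matrices with \<open>m\<close> circulant factors, so \<open>W\<close> is a limit of products of \<open>2K \<le> 4k\<close> matrices of the form \<open>D C\<close>.

  On a bounded set a product of matrices is realized exactly by a network, because large biases keep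
  all hidden preactivations where the activation is the identity; Lipschitz continuity of the layers then handles
  compositions. If some layer has rank \<open>0\<close>, the network is constant and one layer suffices.
\<close>

section \<open>Polynomials in the cyclic shift\<close>

text \<open>The matrix \<open>\<Sum>\<^sub>i D\<^sub>i S\<^sup>i\<close>, where \<open>D\<^sub>i\<close> is diagonal with entries \<open>d i j\<close> and \<open>S\<close> is the cyclic shift
  \<open>(S x)\<^sub>j = x\<^sub>j\<^sub>+\<^sub>1\<close>. Coefficients are formal: \<open>m \<ge> n\<close> is allowed.\<close>

definition band :: "nat \<Rightarrow> nat \<Rightarrow> (nat \<Rightarrow> nat \<Rightarrow> complex) \<Rightarrow> complex mat" where
  "band n m d = mat n n (\<lambda>(j, l). \<Sum>i\<le>m. if (j + i) mod n = l then d i j else 0)"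

lemma band_carrier [simp]: "band n m d \<in> carrier_mat n n"
  by (simp add: band_def)

lemma band_mult_vec:
  assumes "j < n"
  shows "(band n m d *\<^sub>v vec n u) $ j = (\<Sum>i\<le>m. d i j * u ((j + i) mod n))"
proof -
  have "(band n m d *\<^sub>v vec n u) $ j
      = (\<Sum>l<n. \<Sum>i\<le>m. if (j + i) mod n = l then d i j * u l else 0)"
    using assms by (auto simp: band_def scalar_prod_def sum_distrib_right lessThan_atLeast0
        intro!: sum.cong)
  also have "\<dots> = (\<Sum>i\<le>m. \<Sum>l<n. if (j + i) mod n = l then d i j * u l else 0)"
    by (rule sum.swap)
  also have "\<dots> = (\<Sum>i\<le>m. d i j * u ((j + i) mod n))"
    using assms by (auto simp: sum.delta intro!: sum.cong)
  finally show ?thesis .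
qed

lemma det_band_eq_0D:
  assumes "det (band n m d) = 0"
  obtains u where "\<exists>j<n. u j \<noteq> 0" "\<And>j. j < n \<Longrightarrow> (\<Sum>i\<le>m. d i j * u ((j + i) mod n)) = 0"
proof -
  obtain v where v: "v \<in> carrier_vec n" "v \<noteq> 0\<^sub>v n" "band n m d *\<^sub>v v = 0\<^sub>v n"
    using assms det_0_iff_vec_prod_zero_field[OF band_carrier] by blast
  define u where "u j = v $ j" for j
  have vu: "v = vec n u" using v(1) by (auto simp: u_def)
  have "\<exists>j<n. u j \<noteq> 0"
    using v(1,2) by (auto simp: u_def vec_eq_iff)
  moreover have "(\<Sum>i\<le>m. d i j * u ((j + i) mod n)) = 0" if "j < n" for j
    using band_mult_vec[OF that, of m d u] v(3) that by (simp add: vu)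
  ultimately show ?thesis using that by blast
qed

text \<open>The exponents \<open>e\<close> are left free because the lemma serves twice: with
  \<open>i\<close> for the twisted determinant and with \<open>m - i\<close> for its
  reversal.\<close>

lemma poly_det_band:
  "poly (det (mat n n (\<lambda>(j, l). \<Sum>i\<le>m. if (j + i) mod n = l then monom (d i j) (e i) else 0))) z
     = det (band n m (\<lambda>i j. d i j * z ^ e i))"
  by (rule poly_det_cong[of _ n])
     (auto simp: band_def poly_sum poly_monom intro!: sum.cong)

text \<open>The determinant of \<open>\<Sum>\<^sub>i D\<^sub>i z\<^sup>i S\<^sup>i\<close> is a polynomial in \<open>z\<close> with
  nonzero value at \<open>0\<close>; it is not constant, since its reversal is nonzero at \<open>0\<close> as well.\<close>

lemma exists_twisted_kernel:
  fixes d :: "nat \<Rightarrow> nat \<Rightarrow> complex"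
  assumes n: "n > 0" and m: "m > 0"
    and d0: "\<And>j. j < n \<Longrightarrow> d 0 j \<noteq> 0" and dm: "\<And>j. j < n \<Longrightarrow> d m j \<noteq> 0"
  obtains z u where "z \<noteq> 0" "\<exists>j<n. u j \<noteq> 0"
    "\<And>j. j < n \<Longrightarrow> (\<Sum>i\<le>m. d i j * z ^ i * u ((j + i) mod n)) = 0"
proof -
  define p where "p = det (mat n n (\<lambda>(j, l). \<Sum>i\<le>m. if (j + i) mod n = l then monom (d i j) i else 0))"
  define q where "q = det (mat n n (\<lambda>(j, l). \<Sum>i\<le>m. if (j + i) mod n = l then monom (d i j) (m - i) else 0))"
  have p: "poly p z = det (band n m (\<lambda>i j. d i j * z ^ i))" for z
    unfolding p_def by (rule poly_det_band)
  have q: "poly q z = det (band n m (\<lambda>i j. d i j * z ^ (m - i)))" for z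
    unfolding q_def by (rule poly_det_band)
  have p0: "poly p 0 \<noteq> 0"
  proof
    assume "poly p 0 = 0"
    from this[unfolded p] obtain u where u: "\<exists>j<n. u j \<noteq> 0"
      "\<And>j. j < n \<Longrightarrow> (\<Sum>i\<le>m. d i j * 0 ^ i * u ((j + i) mod n)) = 0"
      by (rule det_band_eq_0D) blast
    have "(\<Sum>i\<le>m. d i j * 0 ^ i * u ((j + i) mod n)) = d 0 j * u j" if "j < n" for j
    proof -
      have "(\<Sum>i\<le>m. d i j * 0 ^ i * u ((j + i) mod n)) = (\<Sum>i\<in>{0}. d i j * 0 ^ i * u ((j + i) mod n))"
        by (rule sum.mono_neutral_right) auto
      then show ?thesis using that by simp
    qed
    then show False using u d0 by auto
  qed
  have q0: "poly q 0 \<noteq> 0"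
  proof
    assume "poly q 0 = 0"
    from this[unfolded q] obtain u where u: "\<exists>j<n. u j \<noteq> 0"
      "\<And>j. j < n \<Longrightarrow> (\<Sum>i\<le>m. d i j * 0 ^ (m - i) * u ((j + i) mod n)) = 0"
      by (rule det_band_eq_0D) blast
    have *: "(\<Sum>i\<le>m. d i j * 0 ^ (m - i) * u ((j + i) mod n)) = d m j * u ((j + m) mod n)" for j
    proof -
      have "(\<Sum>i\<le>m. d i j * 0 ^ (m - i) * u ((j + i) mod n)) = (\<Sum>i\<in>{m}. d i j * 0 ^ (m - i) * u ((j + i) mod n))"
        by (rule sum.mono_neutral_right) auto
      then show ?thesis by simp
    qed
    have "u l = 0" if "l < n" for l
    proof -
      \<comment> \<open>The preimage of \<open>l\<close> under the shift by \<open>m\<close>;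
        reducing \<open>m\<close> modulo \<open>n\<close> first avoids truncated subtraction, as
        \<open>m\<close> may exceed \<open>n\<close>.\<close>
      define j where "j = (l + (n - m mod n)) mod n"
      have "j < n" using n by (simp add: j_def)
      have "(j + m) mod n = (l + (n - m mod n) + m mod n) mod n"
        unfolding j_def by (metis mod_add_eq mod_mod_trivial)
      also have "l + (n - m mod n) + m mod n = l + n"
        using n mod_less_divisor[of n m] by linarith
      finally have "(j + m) mod n = l" using that by simp
      then show ?thesis using u(2)[OF \<open>j < n\<close>] dm[OF \<open>j < n\<close>] by (simp add: *)
    qed
    then show False using u(1) by auto
  qed
  have "\<exists>z. z \<noteq> 0 \<and> poly p z = 0"
  proof (rule ccontr)
    assume "\<not> ?thesis"
    then have nz: "poly p z \<noteq> 0" for z using p0 by (cases "z = 0") auto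
    then have "constant (poly p)" using fundamental_theorem_of_algebra by blast
    then obtain c where c: "poly p z = c" for z by (auto simp: constant_def)
    have "poly q z = c * z ^ (m * n)" if "z \<noteq> 0" for z
    proof -
      \<comment> \<open>Each of the \<open>n\<close> rows yields a factor \<open>z ^ m\<close>, so
        the determinants differ by \<open>z ^ (m * n)\<close>.\<close>
      have "band n m (\<lambda>i j. d i j * z ^ (m - i)) = z ^ m \<cdot>\<^sub>m band n m (\<lambda>i j. d i j * (1 / z) ^ i)"
        using that by (intro eq_matI)
          (auto simp: band_def sum_distrib_left power_diff power_one_over field_simps intro!: sum.cong)
      then show ?thesis
        using q[of z] p[of "1 / z"] c[of "1 / z"] by (simp add: band_def power_mult)
    qed
    \<comment> \<open>The identity is known only for \<open>z \<noteq> 0\<close>; multiplying by the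
      indeterminate makes it hold at \<open>0\<close> too, and that factor cancels afterwards. Then
      \<open>q\<close> is a multiple of a positive power and vanishes at \<open>0\<close>.\<close>
    then have "poly ([:0, 1:] * (q - monom c (m * n))) = poly 0"
      by (auto simp: poly_monom fun_eq_iff)
    then have "[:0, 1:] * (q - monom c (m * n)) = 0"
      using poly_eq_poly_eq_iff by blast
    then have "q = monom c (m * n)" by (simp del: mult_pCons_left)
    then show False using q0 n m by (simp add: poly_monom)
  qed
  then obtain z where z: "z \<noteq> 0" "poly p z = 0" by blast
  from z(2)[unfolded p] show ?thesis
    by (rule det_band_eq_0D) (use z(1) that in blast)
qed

lemma band_mult_index:
  assumes "j < n" "l < n" "B \<in> carrier_mat n n"
  shows "(band n m d * B) $$ (j, l) = (\<Sum>i\<le>m. d i j * B $$ ((j + i) mod n, l))"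
proof -
  have "col B l = vec n (\<lambda>i. B $$ (i, l))"
    using assms by auto
  then show ?thesis
    using assms band_mult_vec[of j n m d "\<lambda>i. B $$ (i, l)"] by (simp add: band_def)
qed

text \<open>A kernel vector \<open>u\<close> of the twisted matrix may have zero entries. These are replaced by \<open>\<delta>\<close>, and in
  each row the resulting defect, which is linear in \<open>\<delta>\<close>, is absorbed by the coefficient at a position
  where \<open>u\<close> was nonzero.\<close>

lemma exists_singular_perturbation:
  fixes d :: "nat \<Rightarrow> nat \<Rightarrow> complex"
  assumes n: "n > 0" and m: "m > 0" and \<epsilon>: "\<epsilon> > 0"
  obtains d' z u where "\<And>i j. j < n \<Longrightarrow> cmod (d' i j - d i j) < \<epsilon>"
    "z \<noteq> 0" "\<And>j. j < n \<Longrightarrow> u j \<noteq> 0"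
    "\<And>j. j < n \<Longrightarrow> (\<Sum>i\<le>m. d' i j * z ^ i * u ((j + i) mod n)) = 0"
proof -
  \<comment> \<open>Half of the tolerance is spent on making all coefficients nonzero, as the
    twisted kernel needs for the two extreme ones; the other half pays for the correction of
    \<open>u\<close>.\<close>
  define d1 where "d1 i j = (if d i j = 0 then of_real (\<epsilon> / 2) else d i j)" for i j
  have d1_nz: "d1 i j \<noteq> 0" for i j using \<epsilon> by (simp add: d1_def)
  have d1_close: "cmod (d1 i j - d i j) \<le> \<epsilon> / 2" for i j using \<epsilon> by (simp add: d1_def)
  obtain z u where z: "z \<noteq> 0" and u: "\<exists>j<n. u j \<noteq> 0"
    "\<And>j. j < n \<Longrightarrow> (\<Sum>i\<le>m. d1 i j * z ^ i * u ((j + i) mod n)) = 0"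
    using exists_twisted_kernel[of n m d1, OF n m d1_nz d1_nz] by blast
  have "\<exists>i\<le>m. u ((j + i) mod n) \<noteq> 0" if "j < n" for j
  proof (rule ccontr)
    assume "\<not> ?thesis"
    then have zero: "u ((j + i) mod n) = 0" if "i \<le> m" for i using that by blast
    \<comment> \<open>A window of zeros propagates forward because the leading coefficient is nonzero.\<close>
    have all: "u ((j + t) mod n) = 0" for t
    proof (induction t rule: less_induct)
      case (less t)
      show ?case
      proof (cases "t \<le> m")
        case False
        define k where "k = (j + (t - m)) mod n"
        have k: "k < n" using n by (simp add: k_def)
        have idx: "(k + i) mod n = (j + (t - m + i)) mod n" for i
          by (simp add: k_def mod_add_left_eq add.assoc)
        have "(\<Sum>i\<le>m. d1 i k * z ^ i * u ((k + i) mod n)) = (\<Sum>i\<in>{m}. d1 i k * z ^ i * u ((k + i) mod n))"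
        proof (rule sum.mono_neutral_right)
          show "\<forall>i\<in>{..m} - {m}. d1 i k * z ^ i * u ((k + i) mod n) = 0"
          proof
            fix i assume "i \<in> {..m} - {m}"
            then have "t - m + i < t" using False by auto
            then show "d1 i k * z ^ i * u ((k + i) mod n) = 0" using less by (simp add: idx)
          qed
        qed auto
        then show ?thesis using u(2)[OF k] d1_nz z False by (simp add: idx)
      qed (use zero in blast)
    qed
    have "u l = 0" if "l < n" for l
      using all[of "n - j + l"] \<open>j < n\<close> that by simp
    then show False using u(1) by blast
  qed
  then obtain s where s: "\<And>j. j < n \<Longrightarrow> s j \<le> m" "\<And>j. j < n \<Longrightarrow> u ((j + s j) mod n) \<noteq> 0"
    by metis
  \<comment> \<open>Putting \<delta> at the zeros of \<open>u\<close> creates the defect \<delta>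
    times this numerator in row \<open>j\<close>; lowering the coefficient at \<open>s j\<close> by
    \<delta> times \<open>r j\<close> cancels it.\<close>
  define r where "r j = (\<Sum>i\<le>m. if u ((j + i) mod n) = 0 then d1 i j * z ^ i else 0)
      / (z ^ s j * u ((j + s j) mod n))" for j
  define \<delta> where "\<delta> = \<epsilon> / (4 * (1 + (\<Sum>j<n. cmod (r j))))"
  have pos: "1 + (\<Sum>j<n. cmod (r j)) > 0" by (rule add_pos_nonneg) (auto intro: sum_nonneg)
  then have \<delta>: "\<delta> > 0" using \<epsilon> by (simp add: \<delta>_def)
  have r_le: "\<delta> * cmod (r j) < \<epsilon> / 2" if "j < n" for j
  proof -
    have "cmod (r j) \<le> (\<Sum>j<n. cmod (r j))" using that by (intro member_le_sum) auto
    then have "\<delta> * cmod (r j) \<le> \<delta> * (1 + (\<Sum>j<n. cmod (r j)))" using \<delta> by (intro mult_left_mono) auto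
    also have "\<dots> = \<epsilon> / 4" using pos by (simp add: \<delta>_def field_simps)
    finally show ?thesis using \<epsilon> by simp
  qed
  define u' where "u' j = (if u j = 0 then of_real \<delta> else u j)" for j
  define d' where "d' i j = d1 i j - (if i = s j then of_real \<delta> * r j else 0)" for i j
  show ?thesis
  proof (rule that[of d' z u'])
    fix i j assume j: "j < n"
    have "cmod (d' i j - d i j) \<le> cmod (d1 i j - d i j) + cmod (if i = s j then of_real \<delta> * r j else 0)"
    proof -
      have "d' i j - d i j = (d1 i j - d i j) - (if i = s j then of_real \<delta> * r j else 0)"
        by (simp add: d'_def)
      then show ?thesis by (simp only: norm_triangle_ineq4)
    qed
    also have "cmod (if i = s j then of_real \<delta> * r j else 0) < \<epsilon> / 2"
      using r_le[OF j] \<epsilon> \<delta> by (simp add: norm_mult)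
    finally show "cmod (d' i j - d i j) < \<epsilon>" using d1_close[of i j] by simp
  next
    show "z \<noteq> 0" by fact
  next
    show "u' j \<noteq> 0" if "j < n" for j using \<delta> by (simp add: u'_def)
  next
    fix j assume j: "j < n"
    let ?t = "\<lambda>i. (j + i) mod n"
    have "(\<Sum>i\<le>m. d1 i j * z ^ i * u' (?t i))
        = (\<Sum>i\<le>m. d1 i j * z ^ i * u (?t i)) + of_real \<delta> * (\<Sum>i\<le>m. if u (?t i) = 0 then d1 i j * z ^ i else 0)"
      unfolding sum_distrib_left sum.distrib[symmetric]
      by (rule sum.cong) (auto simp: u'_def)
    also have "\<dots> = of_real \<delta> * r j * (z ^ s j * u (?t (s j)))"
      using u(2)[OF j] s(2)[OF j] z by (simp add: r_def)
    finally have "(\<Sum>i\<le>m. d1 i j * z ^ i * u' (?t i)) = of_real \<delta> * r j * (z ^ s j * u (?t (s j)))" .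
    moreover have "(\<Sum>i\<le>m. (if i = s j then of_real \<delta> * r j else 0) * z ^ i * u' (?t i))
        = of_real \<delta> * r j * (z ^ s j * u (?t (s j)))"
    proof -
      have "(\<Sum>i\<le>m. (if i = s j then of_real \<delta> * r j else 0) * z ^ i * u' (?t i))
        = (\<Sum>i\<in>{s j}. (if i = s j then of_real \<delta> * r j else 0) * z ^ i * u' (?t i))"
        using s(1)[OF j] by (intro sum.mono_neutral_right) auto
      then show ?thesis using s(2)[OF j] by (simp add: u'_def)
    qed
    ultimately show "(\<Sum>i\<le>m. d' i j * z ^ i * u' (?t i)) = 0"
      by (simp add: d'_def left_diff_distrib sum_subtractf)
  qed
qed

text \<open>Division in the skew polynomial ring: after the substitution \<open>S \<mapsto> z S\<close> the operator kills \<open>u\<close>, so it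
  is right divisible by \<open>(S - 1) diag(1/u)\<close>.\<close>

lemma band_factor:
  fixes d :: "nat \<Rightarrow> nat \<Rightarrow> complex"
  assumes z: "z \<noteq> 0" and u: "\<And>j. j < n \<Longrightarrow> u j \<noteq> 0"
    and ker: "\<And>j. j < n \<Longrightarrow> (\<Sum>i\<le>Suc k. d i j * z ^ i * u ((j + i) mod n)) = 0"
  obtains q where "band n (Suc k) d = band n k q *
     (mat n n (\<lambda>(j, l). (if (j + 1) mod n = l then 1 / z else 0) - (if j = l then 1 else 0)) *
      mat n n (\<lambda>(j, l). if j = l then 1 / u j else 0))"
proof
  let ?C = "mat n n (\<lambda>(j, l). (if (j + 1) mod n = l then 1 / z else 0) - (if j = l then 1 else 0))"
  let ?D = "mat n n (\<lambda>(j, l). if j = l then 1 / u j else 0)"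
  \<comment> \<open>Up to sign and scaling, the quotient coefficients are the partial sums of the
    kernel relation.\<close>
  define q where "q i j = - (\<Sum>a\<le>i. d a j * z ^ a * u ((j + a) mod n)) / z ^ i" for i j
  show "band n (Suc k) d = band n k q * (?C * ?D)"
  proof (rule eq_matI)
    fix j l assume "j < dim_row (band n k q * (?C * ?D))" "l < dim_col (band n k q * (?C * ?D))"
    then have j: "j < n" and l: "l < n" by (simp_all add: band_def)
    define e where "e i = (if (j + i) mod n = l then 1 / (z ^ i * u l) else 0)" for i
    define g where "g i = (\<Sum>a\<le>i. d a j * z ^ a * u ((j + a) mod n))" for i
    have CD: "(?C * ?D) $$ (t, l) = ((if (t + 1) mod n = l then 1 / z else 0) - (if t = l then 1 else 0)) / u l"
      if "t < n" for t
    proof -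
      have "(?C * ?D) $$ (t, l) = (\<Sum>s\<in>{0..<n}. ?C $$ (t, s) * ?D $$ (s, l))"
        using that l by (simp add: scalar_prod_def)
      also have "\<dots> = (\<Sum>s\<in>{l}. ?C $$ (t, s) * ?D $$ (s, l))"
        using that l by (intro sum.mono_neutral_right) auto
      finally show ?thesis using that l by simp
    qed
    have "(band n k q * (?C * ?D)) $$ (j, l) = (\<Sum>i\<le>k. q i j * (?C * ?D) $$ ((j + i) mod n, l))"
      by (rule band_mult_index[OF j l]) auto
    also have "\<dots> = (\<Sum>i\<le>k. g i * (e i - e (Suc i)))"
    proof (rule sum.cong)
      fix i
      have "(j + i) mod n < n" using j by simp
      from CD[OF this] have "q i j * (?C * ?D) $$ ((j + i) mod n, l) = - g i / z ^ i *
          (((if (j + Suc i) mod n = l then 1 / z else 0) - (if (j + i) mod n = l then 1 else 0)) / u l)"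
        by (simp add: q_def g_def mod_Suc_eq)
      also have "\<dots> = g i * (e i - e (Suc i))"
        using z u[OF l] unfolding e_def by (simp add: field_simps)
      finally show "q i j * (?C * ?D) $$ ((j + i) mod n, l) = g i * (e i - e (Suc i))" .
    qed simp
    \<comment> \<open>Summation by parts. Since the full sum in \<open>ker\<close> is zero, the
      boundary term is then exactly the missing summand for \<open>Suc k\<close>.\<close>
    also have "\<dots> = (\<Sum>i\<le>k. d i j * z ^ i * u ((j + i) mod n) * e i) - g k * e (Suc k)"
    proof -
      have "(\<Sum>i\<le>k. g i * (e i - e (Suc i)))
          = (\<Sum>i\<le>k. d i j * z ^ i * u ((j + i) mod n) * e i) - g k * e (Suc k)" for k
        by (induction k) (simp_all add: g_def algebra_simps)
      then show ?thesis .
    qed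
    also have "\<dots> = (\<Sum>i\<le>Suc k. d i j * z ^ i * u ((j + i) mod n) * e i)"
    proof -
      have *: "d (Suc k) j * z ^ Suc k * u ((j + Suc k) mod n) = - g k"
        using ker[OF j] by (simp add: g_def eq_neg_iff_add_eq_0 add.commute)
      show ?thesis unfolding sum.atMost_Suc * by simp
    qed
    also have "\<dots> = (\<Sum>i\<le>Suc k. if (j + i) mod n = l then d i j else 0)"
      using z u[OF l] by (intro sum.cong) (auto simp: e_def)
    also have "\<dots> = band n (Suc k) d $$ (j, l)" using j l by (simp add: band_def)
    finally show "band n (Suc k) d $$ (j, l) = (band n k q * (?C * ?D)) $$ (j, l)" by simp
  qed (auto simp: band_def)
qed

section \<open>Diagonal-circulant products and their limits\<close>

lemma circulant_matI:
  assumes "A \<in> carrier_mat n n"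
    and "\<And>j l. j < n \<Longrightarrow> l < n \<Longrightarrow> A $$ (j, l) = f ((int j - int l) mod int n)"
  shows "circulant_mat A"
  unfolding circulant_mat_def
proof (intro conjI bexI allI impI)
  show "square_mat A" using assms(1) by auto
  show "vec n (\<lambda>r. f (int r)) \<in> carrier_vec (dim_row A)" using assms(1) by simp
  fix j l assume "j < dim_row A" "l < dim_row A"
  then have jl: "j < n" "l < n" using assms(1) by auto
  then have "nat ((int j - int l) mod int n) < n"
    by (simp add: nat_less_iff)
  then show "A $$ (j, l) = vec n (\<lambda>r. f (int r)) $ nat ((int j - int l) mod int (dim_row A))"
    using assms(1) jl by (simp add: assms(2))
qed

lemma circulant_matE:
  assumes "circulant_mat A" "A \<in> carrier_mat n n"
  obtains f where "\<And>j l. j < n \<Longrightarrow> l < n \<Longrightarrow> A $$ (j, l) = f ((int j - int l) mod int n)"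
proof -
  obtain c where "\<forall>j<n. \<forall>l<n. A $$ (j, l) = c $ nat ((int j - int l) mod int n)"
    using assms by (auto simp: circulant_mat_def)
  then show ?thesis by (intro that[of "\<lambda>r. c $ nat r"]) auto
qed

lemma circulant_mat_transpose:
  assumes "circulant_mat A" "A \<in> carrier_mat n n"
  shows "circulant_mat (transpose_mat A)"
proof -
  obtain f where f: "\<And>j l. j < n \<Longrightarrow> l < n \<Longrightarrow> A $$ (j, l) = f ((int j - int l) mod int n)"
    using circulant_matE[OF assms] by blast
  show ?thesis
  proof (rule circulant_matI[of _ n "\<lambda>r. f (- r mod int n)"])
    show "transpose_mat A $$ (j, l) = f (- ((int j - int l) mod int n) mod int n)"
      if "j < n" "l < n" for j l
      using that assms(2) f[OF that(2,1)] by (simp add: mod_minus_eq)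
  qed (use assms(2) in simp)
qed

lemma circulant_one: "circulant_mat (1\<^sub>m n)"
proof (rule circulant_matI[of _ n "\<lambda>r. if r = 0 then 1 else 0"])
  fix j l assume jl: "j < n" "l < n"
  have "(int j - int l) mod int n = 0 \<longleftrightarrow> j = l"
    using jl mod_eq_dvd_iff[of "int j" "int n" "int l"] by (auto simp: dvd_eq_mod_eq_0)
  then show "1\<^sub>m n $$ (j, l) = (if (int j - int l) mod int n = 0 then 1 else 0)"
    using jl by simp
qed simp

lemma circulant_shift_minus_one:
  "circulant_mat (mat n n (\<lambda>(j, l). (if (j + 1) mod n = l then w else 0) - (if j = l then 1 else 0)))"
\<comment> \<open>The shift sits at index difference -1. Writing it as a residue also covers
  \<open>n = 1\<close>, where it coincides with the diagonal.\<close>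
proof (rule circulant_matI[of _ n "\<lambda>r. (if r = - 1 mod int n then w else 0) - (if r = 0 then 1 else 0)"])
  fix j l assume jl: "j < n" "l < n"
  have "(int j - int l) mod int n = 0 \<longleftrightarrow> j = l"
    using jl mod_eq_dvd_iff[of "int j" "int n" "int l"] by (auto simp: dvd_eq_mod_eq_0)
  moreover have "(int j - int l) mod int n = - 1 mod int n \<longleftrightarrow> (j + 1) mod n = l"
  proof -
    have "(int j - int l) mod int n = - 1 mod int n \<longleftrightarrow> int (j + 1) mod int n = int l mod int n"
      unfolding mod_eq_dvd_iff by (simp add: algebra_simps)
    also have "\<dots> \<longleftrightarrow> (j + 1) mod n = l"
      using jl by (metis mod_less of_nat_eq_iff zmod_int)
    finally show ?thesis .
  qed
  ultimately show "mat n n (\<lambda>(j, l). (if (j + 1) mod n = l then w else 0) - (if j = l then 1 else 0)) $$ (j, l)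
      = (if (int j - int l) mod int n = - 1 mod int n then w else 0)
        - (if (int j - int l) mod int n = 0 then 1 else 0)"
    using jl by simp
qed simp

text \<open>Because \<open>k\<close> divides \<open>n\<close>, the index difference modulo
  \<open>n\<close> still determines it modulo \<open>k\<close>.\<close>

lemma circulant_mod_eq:
  assumes "k dvd n"
  shows "circulant_mat (mat n n (\<lambda>(j, l). if j mod k = l mod k then 1 else 0))"
proof (rule circulant_matI[of _ n "\<lambda>r. if r mod int k = 0 then 1 else 0"])
  fix j l assume jl: "j < n" "l < n"
  have "(int j - int l) mod int n mod int k = (int j - int l) mod int k"
    using assms by (simp add: mod_mod_cancel)
  also have "\<dots> = 0 \<longleftrightarrow> int j mod int k = int l mod int k"
    by (simp add: mod_eq_dvd_iff dvd_eq_mod_eq_0)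
  also have "\<dots> \<longleftrightarrow> j mod k = l mod k"
    by (metis of_nat_eq_iff zmod_int)
  finally show "mat n n (\<lambda>(j, l). if j mod k = l mod k then 1 else 0) $$ (j, l)
      = (if (int j - int l) mod int n mod int k = 0 then 1 else 0)"
    using jl by simp
qed simp

lemma diagonal_mat_mult:
  fixes D E :: "complex mat"
  assumes "D \<in> carrier_mat n n" "diagonal_mat D" "E \<in> carrier_mat n n" "diagonal_mat E"
  shows "diagonal_mat (D * E)"
  unfolding diagonal_mat_def
proof (intro allI impI)
  fix i j assume ij: "i < dim_row (D * E)" "j < dim_col (D * E)" "i \<noteq> j"
  have "(D * E) $$ (i, j) = (\<Sum>s\<in>{0..<n}. D $$ (i, s) * E $$ (s, j))"
    using ij assms by (simp add: scalar_prod_def)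
  also have "\<dots> = 0"
  proof (rule sum.neutral, rule ballI)
    fix s assume "s \<in> {0..<n}"
    then show "D $$ (i, s) * E $$ (s, j) = 0"
      using ij assms by (cases "s = i") (auto simp: diagonal_mat_def)
  qed
  finally show "(D * E) $$ (i, j) = 0" .
qed

text \<open>Products \<open>D\<^sub>0 C\<^sub>1 D\<^sub>1 \<dots> C\<^sub>r D\<^sub>r\<close>. The final diagonal matrix lets such products be
  multiplied without increasing the number of circulant factors.\<close>

inductive dc_prod :: "nat \<Rightarrow> nat \<Rightarrow> complex mat \<Rightarrow> bool" for n where
  diag: "D \<in> carrier_mat n n \<Longrightarrow> diagonal_mat D \<Longrightarrow> dc_prod n 0 D"
| step: "D \<in> carrier_mat n n \<Longrightarrow> diagonal_mat D \<Longrightarrow> C \<in> carrier_mat n n \<Longrightarrow> circulant_mat C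
    \<Longrightarrow> dc_prod n r A \<Longrightarrow> dc_prod n (Suc r) (D * C * A)"

lemma dc_prod_carrier: "dc_prod n r A \<Longrightarrow> A \<in> carrier_mat n n"
  by (induction rule: dc_prod.induct) auto

lemma dc_prod_diag_mult:
  assumes "D \<in> carrier_mat n n" "diagonal_mat D" "dc_prod n r A"
  shows "dc_prod n r (D * A)"
  using assms(3)
proof cases
  case diag
  then show ?thesis using assms(1,2) by (auto intro: dc_prod.diag diagonal_mat_mult)
next
  case (step D' C r' A')
  have eq: "D * A = D * D' * C * A'"
    using assms(1) step dc_prod_carrier[OF step(7)]
    by (simp add: assoc_mult_mat[of _ n n _ n _ n])
  show ?thesis
    unfolding eq step(1) using assms(1,2) step(3-7)
    by (intro dc_prod.step diagonal_mat_mult[of _ n]) auto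
qed

text \<open>Where the two products meet, the last diagonal matrix of \<open>A\<close> merges with
  the first one of \<open>B\<close>, so only circulant factors are counted.\<close>

lemma dc_prod_mult:
  assumes "dc_prod n r A" "dc_prod n s B"
  shows "dc_prod n (r + s) (A * B)"
  using assms(1)
proof induction
  case (diag D)
  then show ?case using assms(2) by (simp add: dc_prod_diag_mult)
next
  case (step D C r A)
  have "D * C * A * B = D * C * (A * B)"
    using step dc_prod_carrier[OF step(5)] dc_prod_carrier[OF assms(2)]
    by (simp add: assoc_mult_mat[of _ n n _ n _ n])
  then show ?case using step by (auto intro: dc_prod.step)
qed

lemma diagonal_one: "diagonal_mat (1\<^sub>m n :: complex mat)"
  by (simp add: diagonal_mat_def)

lemma dc_prod_circulant_diag:
  assumes "C \<in> carrier_mat n n" "circulant_mat C" "D \<in> carrier_mat n n" "diagonal_mat D"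
  shows "dc_prod n 1 (C * D)"
  using dc_prod.step[OF one_carrier_mat diagonal_one assms(1,2) dc_prod.diag[OF assms(3,4)]] assms
  by simp

text \<open>The shape, with diagonal matrices at both ends, is symmetric under reversal. This makes
  the transposed band factor of a low-rank matrix as cheap as the other one.\<close>

lemma dc_prod_transpose:
  "dc_prod n r A \<Longrightarrow> dc_prod n r (transpose_mat A)"
proof (induction rule: dc_prod.induct)
  case (diag D)
  then show ?case by (auto intro!: dc_prod.diag simp: diagonal_mat_def)
next
  case (step D C r A)
  have "transpose_mat (D * C * A) = transpose_mat A * (transpose_mat C * transpose_mat D)"
    using step dc_prod_carrier[OF step(5)] transpose_mult[of "D * C" n n A n] transpose_mult[of D n n C n]
    by simp
  moreover have "dc_prod n 1 (transpose_mat C * transpose_mat D)"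
    using step by (intro dc_prod_circulant_diag circulant_mat_transpose) (auto simp: diagonal_mat_def)
  ultimately show ?case using dc_prod_mult[OF step.IH] by fastforce
qed

section \<open>Limits of diagonal-circulant products\<close>

definition dc_approx :: "nat \<Rightarrow> nat \<Rightarrow> complex mat \<Rightarrow> bool" where
  "dc_approx n r A \<longleftrightarrow> A \<in> carrier_mat n n \<and>
     (\<forall>\<epsilon>>0. \<exists>B. dc_prod n r B \<and> (\<forall>j<n. \<forall>l<n. cmod (B $$ (j, l) - A $$ (j, l)) < \<epsilon>))"

lemma dc_prod_imp_approx: "dc_prod n r A \<Longrightarrow> dc_approx n r A"
  unfolding dc_approx_def using dc_prod_carrier by fastforce

text \<open>Needed because a perturbed band matrix splits into factors of which one is itself only
  known to be a limit.\<close>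

lemma dc_approx_closed:
  assumes "A \<in> carrier_mat n n"
    and "\<And>\<epsilon>. \<epsilon> > 0 \<Longrightarrow> \<exists>B. dc_approx n r B \<and> (\<forall>j<n. \<forall>l<n. cmod (B $$ (j, l) - A $$ (j, l)) < \<epsilon>)"
  shows "dc_approx n r A"
  unfolding dc_approx_def
proof (intro conjI allI impI assms(1))
  fix \<epsilon> :: real assume "\<epsilon> > 0"
  then have e: "\<epsilon> / 2 > 0" by simp
  obtain B where B: "dc_approx n r B" "\<And>j l. j < n \<Longrightarrow> l < n \<Longrightarrow> cmod (B $$ (j, l) - A $$ (j, l)) < \<epsilon> / 2"
    using assms(2)[OF e] by blast
  obtain B' where B': "dc_prod n r B'" "\<And>j l. j < n \<Longrightarrow> l < n \<Longrightarrow> cmod (B' $$ (j, l) - B $$ (j, l)) < \<epsilon> / 2"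
    using B(1) e unfolding dc_approx_def by blast
  have "cmod (B' $$ (j, l) - A $$ (j, l)) < \<epsilon>" if "j < n" "l < n" for j l
    using norm_triangle_lt[of "B' $$ (j, l) - B $$ (j, l)" "B $$ (j, l) - A $$ (j, l)" \<epsilon>]
      B(2)[OF that] B'(2)[OF that] by simp
  then show "\<exists>B. dc_prod n r B \<and> (\<forall>j<n. \<forall>l<n. cmod (B $$ (j, l) - A $$ (j, l)) < \<epsilon>)"
    using B'(1) by blast
qed

text \<open>With sequences, continuity of the matrix product follows from the limit rules for finite
  sums and products.\<close>

lemma dc_approx_iff_tendsto:
  "dc_approx n r A \<longleftrightarrow> A \<in> carrier_mat n n \<and>
     (\<exists>B. (\<forall>k. dc_prod n r (B k)) \<and> (\<forall>j<n. \<forall>l<n. (\<lambda>k. B k $$ (j, l)) \<longlonglongrightarrow> A $$ (j, l)))"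
proof (intro iffI conjI)
  assume A: "dc_approx n r A"
  then show "A \<in> carrier_mat n n" by (simp add: dc_approx_def)
  have "\<exists>B. dc_prod n r B \<and> (\<forall>j<n. \<forall>l<n. cmod (B $$ (j, l) - A $$ (j, l)) < 1 / real (Suc k))" for k
    using A unfolding dc_approx_def by (metis of_nat_0_less_iff zero_less_Suc zero_less_divide_1_iff)
  then obtain B where B: "\<And>k. dc_prod n r (B k)"
    "\<And>k j l. j < n \<Longrightarrow> l < n \<Longrightarrow> cmod (B k $$ (j, l) - A $$ (j, l)) < 1 / real (Suc k)"
    by metis
  have "(\<lambda>k. B k $$ (j, l)) \<longlonglongrightarrow> A $$ (j, l)" if "j < n" "l < n" for j l
  proof -
    have "(\<lambda>k. B k $$ (j, l) - A $$ (j, l)) \<longlonglongrightarrow> 0"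
      using B(2)[OF that] by (intro LIMSEQ_norm_0) simp
    then show ?thesis by (simp add: LIM_zero_iff)
  qed
  then show "\<exists>B. (\<forall>k. dc_prod n r (B k)) \<and> (\<forall>j<n. \<forall>l<n. (\<lambda>k. B k $$ (j, l)) \<longlonglongrightarrow> A $$ (j, l))"
    using B(1) by blast
next
  assume "A \<in> carrier_mat n n \<and>
     (\<exists>B. (\<forall>k. dc_prod n r (B k)) \<and> (\<forall>j<n. \<forall>l<n. (\<lambda>k. B k $$ (j, l)) \<longlonglongrightarrow> A $$ (j, l)))"
  then obtain B where A: "A \<in> carrier_mat n n" and B: "\<And>k. dc_prod n r (B k)"
    "\<And>j l. j < n \<Longrightarrow> l < n \<Longrightarrow> (\<lambda>k. B k $$ (j, l)) \<longlonglongrightarrow> A $$ (j, l)"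
    by blast
  show "dc_approx n r A"
    unfolding dc_approx_def
  proof (intro conjI allI impI A)
    fix \<epsilon> :: real assume "\<epsilon> > 0"
    then have "\<forall>\<^sub>F k in sequentially. cmod (B k $$ (j, l) - A $$ (j, l)) < \<epsilon>" if "j < n" "l < n" for j l
      using tendstoD[OF B(2)[OF that]] by (simp add: dist_norm)
    then have "\<forall>\<^sub>F k in sequentially. \<forall>j\<in>{..<n}. \<forall>l\<in>{..<n}. cmod (B k $$ (j, l) - A $$ (j, l)) < \<epsilon>"
      by (intro eventually_ball_finite ballI) auto
    then obtain k where "\<forall>j\<in>{..<n}. \<forall>l\<in>{..<n}. cmod (B k $$ (j, l) - A $$ (j, l)) < \<epsilon>"
      using eventually_happens'[OF sequentially_bot] by blast
    then show "\<exists>B. dc_prod n r B \<and> (\<forall>j<n. \<forall>l<n. cmod (B $$ (j, l) - A $$ (j, l)) < \<epsilon>)"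
      using B(1) by auto
  qed
qed

lemma dc_approx_mult:
  assumes "dc_approx n r A" "dc_approx n s B"
  shows "dc_approx n (r + s) (A * B)"
proof -
  obtain F where F: "A \<in> carrier_mat n n" "\<And>k. dc_prod n r (F k)"
    "\<And>j l. j < n \<Longrightarrow> l < n \<Longrightarrow> (\<lambda>k. F k $$ (j, l)) \<longlonglongrightarrow> A $$ (j, l)"
    using assms(1) unfolding dc_approx_iff_tendsto by blast
  obtain G where G: "B \<in> carrier_mat n n" "\<And>k. dc_prod n s (G k)"
    "\<And>j l. j < n \<Longrightarrow> l < n \<Longrightarrow> (\<lambda>k. G k $$ (j, l)) \<longlonglongrightarrow> B $$ (j, l)"
    using assms(2) unfolding dc_approx_iff_tendsto by blast
  have "(\<lambda>k. (F k * G k) $$ (j, l)) \<longlonglongrightarrow> (A * B) $$ (j, l)" if "j < n" "l < n" for j l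
  proof -
    have "(\<lambda>k. \<Sum>i\<in>{0..<n}. F k $$ (j, i) * G k $$ (i, l)) \<longlonglongrightarrow> (\<Sum>i\<in>{0..<n}. A $$ (j, i) * B $$ (i, l))"
      using that F(3) G(3) by (intro tendsto_sum tendsto_mult) auto
    moreover have "(F k * G k) $$ (j, l) = (\<Sum>i\<in>{0..<n}. F k $$ (j, i) * G k $$ (i, l))" for k
      using that dc_prod_carrier[OF F(2), of k] dc_prod_carrier[OF G(2), of k]
      by (simp add: scalar_prod_def)
    moreover have "(A * B) $$ (j, l) = (\<Sum>i\<in>{0..<n}. A $$ (j, i) * B $$ (i, l))"
      using that F(1) G(1) by (simp add: scalar_prod_def)
    ultimately show ?thesis by (simp only:)
  qed
  then show ?thesis
    unfolding dc_approx_iff_tendsto using F(1,2) G(1,2) dc_prod_mult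
    by (intro conjI exI[of _ "\<lambda>k. F k * G k"]) auto
qed

lemma dc_approx_transpose:
  assumes "dc_approx n r A"
  shows "dc_approx n r (transpose_mat A)"
  unfolding dc_approx_def
proof (intro conjI allI impI)
  show "transpose_mat A \<in> carrier_mat n n" using assms by (simp add: dc_approx_def)
  fix \<epsilon> :: real assume "\<epsilon> > 0"
  then obtain B where B: "dc_prod n r B" "\<forall>j<n. \<forall>l<n. cmod (B $$ (j, l) - A $$ (j, l)) < \<epsilon>"
    using assms unfolding dc_approx_def by blast
  then have "\<forall>j<n. \<forall>l<n. cmod (transpose_mat B $$ (j, l) - transpose_mat A $$ (j, l)) < \<epsilon>"
    using assms dc_prod_carrier[OF B(1)] by (auto simp: dc_approx_def)
  then show "\<exists>B. dc_prod n r B \<and> (\<forall>j<n. \<forall>l<n. cmod (B $$ (j, l) - transpose_mat A $$ (j, l)) < \<epsilon>)"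
    using dc_prod_transpose[OF B(1)] by blast
qed

lemma dc_approx_band:
  assumes "n > 0"
  shows "dc_approx n m (band n m d)"
proof (induction m arbitrary: d)
  case 0
  have "diagonal_mat (band n 0 d)" by (simp add: diagonal_mat_def band_def)
  then show ?case by (intro dc_prod_imp_approx dc_prod.diag) auto
next
  case (Suc m)
  show ?case
  proof (rule dc_approx_closed)
    fix \<epsilon> :: real assume "\<epsilon> > 0"
    \<comment> \<open>There are \<open>m + 2\<close> coefficients, and as the degree may reach
      \<open>n\<close>, several of their errors can fall on one entry.\<close>
    then have pos: "\<epsilon> / (real m + 2) > 0" by simp
    obtain d' z u where d': "\<And>i j. j < n \<Longrightarrow> cmod (d' i j - d i j) < \<epsilon> / (real m + 2)"
      and zu: "z \<noteq> 0" "\<And>j. j < n \<Longrightarrow> u j \<noteq> 0"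
      "\<And>j. j < n \<Longrightarrow> (\<Sum>i\<le>Suc m. d' i j * z ^ i * u ((j + i) mod n)) = 0"
      using exists_singular_perturbation[OF assms zero_less_Suc pos] by blast
    obtain q where eq: "band n (Suc m) d' = band n m q *
       (mat n n (\<lambda>(j, l). (if (j + 1) mod n = l then 1 / z else 0) - (if j = l then 1 else 0)) *
        mat n n (\<lambda>(j, l). if j = l then 1 / u j else 0))"
      using band_factor[OF zu] by blast
    have "dc_approx n (m + 1) (band n (Suc m) d')"
      unfolding eq
      by (intro dc_approx_mult Suc.IH dc_prod_imp_approx dc_prod_circulant_diag circulant_shift_minus_one)
        (auto simp: diagonal_mat_def)
    moreover have "cmod (band n (Suc m) d' $$ (j, l) - band n (Suc m) d $$ (j, l)) < \<epsilon>"
      if "j < n" "l < n" for j l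
    proof -
      have "cmod (band n (Suc m) d' $$ (j, l) - band n (Suc m) d $$ (j, l))
         = cmod (\<Sum>i\<le>Suc m. if (j + i) mod n = l then d' i j - d i j else 0)"
        using that by (simp only: band_def index_mat prod.case sum_subtractf[symmetric])
          (rule arg_cong[of _ _ cmod], rule sum.cong, auto)
      also have "\<dots> \<le> (\<Sum>i\<le>Suc m. cmod (if (j + i) mod n = l then d' i j - d i j else 0))"
        by (rule norm_sum)
      also have "\<dots> < (\<Sum>i\<le>Suc m. \<epsilon> / (real m + 2))"
        using d'[OF that(1)] pos by (intro sum_strict_mono) auto
      also have "\<dots> = \<epsilon>" by (simp add: field_simps)
      finally show ?thesis .
    qed
    ultimately show "\<exists>B. dc_approx n (Suc m) B
        \<and> (\<forall>j<n. \<forall>l<n. cmod (B $$ (j, l) - band n (Suc m) d $$ (j, l)) < \<epsilon>)"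
      by auto
  qed simp
qed

section \<open>Matrices of low rank\<close>

text \<open>A maximal independent set of columns spans all columns and has as many elements as the
  rank. Zero padding up to \<open>k\<close> allows the rank to be rounded up.\<close>

lemma rank_factorization:
  fixes W :: "complex mat"
  assumes W: "W \<in> carrier_mat n n" and k: "vec_space.rank n W \<le> k"
  obtains U V where "\<And>j l. j < n \<Longrightarrow> l < n \<Longrightarrow> W $$ (j, l) = (\<Sum>r<k. U j r * V r l)"
proof -
  interpret vec_space "TYPE(complex)" n .
  let ?P = "\<lambda>T. T \<subseteq> set (cols W) \<and> lin_indpt T"
  have "?P {}" by (simp add: lin_dep_def)
  then obtain S where S: "finite S" "maximal S ?P"
    using maximal_exists_superset[of "set (cols W)" ?P "{}"] by blast
  then have SP: "S \<subseteq> set (cols W)" "lin_indpt S" by (auto simp: maximal_def)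
  have cols: "set (cols W) \<subseteq> carrier_vec n" using W cols_dim by blast
  have Sc: "S \<subseteq> carrier_vec n" using SP(1) cols by blast
  have "\<exists>a. w = lincomb a S" if w: "w \<in> set (cols W)" for w
  proof -
    have "w \<in> span S"
    proof (rule ccontr)
      assume nw: "w \<notin> span S"
      have "w \<notin> S" using nw span_mem[OF Sc] by blast
      have "lin_indpt (S \<union> {w})"
        using lin_dep_iff_in_span[of S w] nw SP(2) Sc cols w \<open>w \<notin> S\<close> by auto
      then have "?P (S \<union> {w})" using SP(1) w by blast
      then have "S = S \<union> {w}" using S(2) unfolding maximal_def by blast
      then show False using \<open>w \<notin> S\<close> by blast
    qed
    then show ?thesis using finite_span[OF S(1)] Sc by auto
  qed
  then obtain a where a: "\<And>w. w \<in> set (cols W) \<Longrightarrow> w = lincomb (a w) S" by metis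
  obtain h where h: "bij_betw h {..<card S} S"
    using ex_bij_betw_nat_finite[OF S(1)] by (auto simp: lessThan_atLeast0)
  have card: "card S \<le> k" using k rank_card_indpt[OF W S(2)] by simp
  show ?thesis
  proof (rule that[of "\<lambda>j r. if r < card S then h r $ j else 0" "\<lambda>r l. a (col W l) (h r)"])
    fix j l assume jl: "j < n" "l < n"
    then have col: "col W l \<in> set (cols W)" using W by (auto simp: cols_def)
    have "W $$ (j, l) = col W l $ j" using W jl by simp
    also have "\<dots> = lincomb (a (col W l)) S $ j" using a[OF col] by simp
    also have "\<dots> = (\<Sum>s\<in>S. a (col W l) s * s $ j)" by (rule lincomb_index[OF jl(1) Sc])
    also have "\<dots> = (\<Sum>r<card S. a (col W l) (h r) * h r $ j)"
      by (rule sum.reindex_bij_betw[OF h, symmetric])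
    also have "\<dots> = (\<Sum>r<k. (if r < card S then h r $ j else 0) * a (col W l) (h r))"
      using card by (intro sum.mono_neutral_cong_left) auto
    finally show "W $$ (j, l) = (\<Sum>r<k. (if r < card S then h r $ j else 0) * a (col W l) (h r))" .
  qed
qed

text \<open>Any \<open>K\<close> consecutive integers form a complete residue system modulo
  \<open>K\<close>.\<close>

lemma sum_mod_shift:
  fixes f :: "nat \<Rightarrow> 'a :: comm_monoid_add"
  assumes "K > 0"
  shows "(\<Sum>i<K. f ((j + i) mod K)) = (\<Sum>r<K. f r)"
proof (rule sum.reindex_bij_betw)
  have "inj_on (\<lambda>i. (j + i) mod K) {..<K}"
  proof (rule inj_onI)
    fix x y assume xy: "x \<in> {..<K}" "y \<in> {..<K}" "(j + x) mod K = (j + y) mod K"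
    then have "int x mod int K = int y mod int K"
      by (metis add_diff_cancel_left' mod_diff_left_eq of_nat_add zmod_int)
    then show "x = y" using xy by (metis lessThan_iff mod_less of_nat_eq_iff zmod_int)
  qed
  moreover have "(\<lambda>i. (j + i) mod K) ` {..<K} \<subseteq> {..<K}" using assms by auto
  ultimately show "bij_betw (\<lambda>i. (j + i) mod K) {..<K} {..<K}"
    by (simp add: bij_betw_def endo_inj_surj)
qed

text \<open>A rank factorization \<open>W = U V\<close> becomes \<open>L O R\<^sup>T\<close> with band matrices \<open>L\<close>, \<open>R\<close>, since the columns
  \<open>j, \<dots>, j + m\<close> occupied by row \<open>j\<close> of \<open>L\<close> meet every residue class modulo \<open>m + 1\<close> exactly once.\<close>

lemma dc_approx_rank_dvd:
  fixes W :: "complex mat"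
  assumes W: "W \<in> carrier_mat n n" and n: "n > 0"
    and rank: "vec_space.rank n W \<le> Suc m" and dvd: "Suc m dvd n"
  shows "dc_approx n (2 * m + 1) W"
proof -
  let ?K = "Suc m"
  let ?O = "mat n n (\<lambda>(j, l). if j mod ?K = l mod ?K then 1 else 0) :: complex mat"
  obtain U V where UV: "\<And>j l. j < n \<Longrightarrow> l < n \<Longrightarrow> W $$ (j, l) = (\<Sum>r<?K. U j r * V r l)"
    using rank_factorization[OF W rank] by blast
  define L where "L = band n m (\<lambda>i j. U j ((j + i) mod ?K))"
  define R where "R = band n m (\<lambda>i l. V ((l + i) mod ?K) l)"
  \<comment> \<open>The matrix \<open>?O\<close> is symmetric, so the right factor is
    \<open>?O\<close> times the transpose of \<open>R\<close>; in this form
    \<open>band_mult_index\<close> evaluates both products.\<close>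
  have "W = L * transpose_mat (R * ?O)"
  proof (rule eq_matI)
    fix j l assume "j < dim_row (L * transpose_mat (R * ?O))" "l < dim_col (L * transpose_mat (R * ?O))"
    then have jl: "j < n" "l < n" by (auto simp: L_def R_def band_def)
    have RO: "transpose_mat (R * ?O) $$ (t, l) = V (t mod ?K) l" if "t < n" for t
    proof -
      have "transpose_mat (R * ?O) $$ (t, l) = (R * ?O) $$ (l, t)"
        using that jl by (simp add: R_def band_def)
      also have "\<dots> = (\<Sum>i\<le>m. V ((l + i) mod ?K) l * ?O $$ ((l + i) mod n, t))"
        unfolding R_def using jl that by (intro band_mult_index) auto
      also have "\<dots> = (\<Sum>i<?K. (\<lambda>r. V r l * (if r = t mod ?K then 1 else 0)) ((l + i) mod ?K))"
        using that jl dvd by (simp only: lessThan_Suc_atMost)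
          (intro sum.cong, auto simp: mod_mod_cancel)
      also have "\<dots> = (\<Sum>r<?K. V r l * (if r = t mod ?K then 1 else 0))"
        by (rule sum_mod_shift) simp
      also have "\<dots> = (\<Sum>r\<in>{t mod ?K}. V r l * (if r = t mod ?K then 1 else 0))"
        by (rule sum.mono_neutral_right) auto
      finally show ?thesis by simp
    qed
    have "(L * transpose_mat (R * ?O)) $$ (j, l)
        = (\<Sum>i\<le>m. U j ((j + i) mod ?K) * transpose_mat (R * ?O) $$ ((j + i) mod n, l))"
      unfolding L_def using jl by (intro band_mult_index) (auto simp: R_def band_def)
    also have "\<dots> = (\<Sum>i<?K. (\<lambda>r. U j r * V r l) ((j + i) mod ?K))"
      using jl dvd by (simp only: lessThan_Suc_atMost)
        (intro sum.cong, auto simp: RO mod_mod_cancel)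
    also have "\<dots> = (\<Sum>r<?K. U j r * V r l)"
      by (rule sum_mod_shift) simp
    also have "\<dots> = W $$ (j, l)" using UV jl by simp
    finally show "W $$ (j, l) = (L * transpose_mat (R * ?O)) $$ (j, l)" by simp
  qed (use W in \<open>auto simp: L_def R_def band_def\<close>)
  moreover have "dc_approx n 1 ?O"
    using dc_prod_circulant_diag[of ?O n "1\<^sub>m n"] circulant_mod_eq[OF dvd] diagonal_one
    by (intro dc_prod_imp_approx) simp
  then have "dc_approx n (m + (m + 1)) (L * transpose_mat (R * ?O))"
    unfolding L_def R_def using n
    by (intro dc_approx_mult dc_approx_transpose dc_approx_band)
  ultimately show ?thesis by (simp add: mult_2)
qed

text \<open>The rank is rounded up to a power of two, which divides \<open>n\<close>; this costs a factor less than two.\<close>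

lemma dc_approx_rank:
  fixes W :: "complex mat"
  assumes n: "n = 2 ^ t" and W: "W \<in> carrier_mat n n" and rank: "vec_space.rank n W \<noteq> 0"
  obtains r where "dc_approx n r W" "Suc r \<le> 4 * vec_space.rank n W"
proof -
  interpret vec_space "TYPE(complex)" n .
  define s where "s = (LEAST s. rank W \<le> 2 ^ s)"
  have le_t: "rank W \<le> 2 ^ t" using rank_le_nc[OF W] n by simp
  then have s: "rank W \<le> 2 ^ s" unfolding s_def by (rule LeastI)
  have "s \<le> t" unfolding s_def using le_t by (rule Least_le)
  then have dvd: "2 ^ s dvd n" by (simp add: n le_imp_power_dvd)
  \<comment> \<open>By minimality the previous power is below the rank; if \<open>s = 0\<close>, the
    rank being nonzero suffices.\<close>
  have small: "2 ^ s \<le> 2 * rank W"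
  proof (cases s)
    case (Suc s')
    then have "\<not> rank W \<le> 2 ^ s'" unfolding s_def by (metis not_less_Least lessI s_def)
    then show ?thesis using Suc by simp
  qed (use rank in simp)
  define m where "m = (2::nat) ^ s - 1"
  have m: "Suc m = 2 ^ s" by (simp add: m_def)
  show ?thesis
  proof (rule that)
    show "dc_approx n (2 * m + 1) W"
      using W s dvd n by (intro dc_approx_rank_dvd) (simp_all add: m)
    show "Suc (2 * m + 1) \<le> 4 * rank W" using small m by linarith
  qed
qed

section \<open>Networks\<close>

text \<open>The activation acts on real and imaginary parts separately, and the real one is
  1-Lipschitz.\<close>

lemma crelu_dist_le: "cmod (crelu z - crelu w) \<le> cmod (z - w)"
proof -
  have "\<bar>max 0 x - max 0 y\<bar> \<le> \<bar>x - y\<bar>" for x y :: real by linarith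
  then have "(max 0 x - max 0 y)\<^sup>2 \<le> (x - y)\<^sup>2" for x y :: real by (simp add: abs_le_square_iff)
  then show ?thesis by (simp add: cmod_def crelu_def add_mono)
qed

lemma crelu_eq_self: "0 \<le> Re z \<Longrightarrow> 0 \<le> Im z \<Longrightarrow> crelu z = z"
  by (simp add: crelu_def complex_eq_iff)

lemma layer_carrier [simp]: "W \<in> carrier_mat n n \<Longrightarrow> b \<in> carrier_vec n \<Longrightarrow> layer W b x \<in> carrier_vec n"
  by (rule carrier_vecI) (simp add: layer_def)

lemma layer_index:
  assumes "W \<in> carrier_mat n n" "b \<in> carrier_vec n" "x \<in> carrier_vec n" "i < n"
  shows "layer W b x $ i = crelu ((\<Sum>l<n. W $$ (i, l) * x $ l) + b $ i)"
  using assms by (simp add: layer_def scalar_prod_def lessThan_atLeast0)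

lemma bounded_in_iff:
  "bounded_in n X \<longleftrightarrow> X \<subseteq> carrier_vec n \<and> (\<exists>B. \<forall>x\<in>X. \<forall>i<n. cmod (x $ i) \<le> B)"
proof (cases "X \<subseteq> carrier_vec n")
  case True
  have "(\<exists>B. \<forall>x\<in>X. l2norm x \<le> B) \<longleftrightarrow> (\<exists>B. \<forall>x\<in>X. \<forall>i<n. cmod (x $ i) \<le> B)"
  proof
    assume "\<exists>B. \<forall>x\<in>X. l2norm x \<le> B"
    then obtain B where B: "\<And>x. x \<in> X \<Longrightarrow> l2norm x \<le> B" by blast
    have "cmod (x $ i) \<le> B" if "x \<in> X" "i < n" for x i
      using member_le_L2_set[of "{..<dim_vec x}" i "\<lambda>i. cmod (x $ i)"] B[OF that(1)] that True
      by (auto simp: l2norm_def)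
    then show "\<exists>B. \<forall>x\<in>X. \<forall>i<n. cmod (x $ i) \<le> B" by blast
  next
    assume "\<exists>B. \<forall>x\<in>X. \<forall>i<n. cmod (x $ i) \<le> B"
    then obtain B where B: "\<And>x i. x \<in> X \<Longrightarrow> i < n \<Longrightarrow> cmod (x $ i) \<le> B" by blast
    have "l2norm x \<le> (\<Sum>i<n. B)" if "x \<in> X" for x
    proof -
      have "l2norm x \<le> (\<Sum>i<n. cmod (x $ i))"
        using L2_set_le_sum[of "{..<n}" "\<lambda>i. cmod (x $ i)"] that True by (auto simp: l2norm_def)
      also have "\<dots> \<le> (\<Sum>i<n. B)" using B[OF that] by (intro sum_mono) auto
      finally show ?thesis .
    qed
    then show "\<exists>B. \<forall>x\<in>X. l2norm x \<le> B" by blast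
  qed
  then show ?thesis by (simp add: bounded_in_def)
qed (simp add: bounded_in_def)

lemma bounded_in_mult:
  assumes "A \<in> carrier_mat n n" "bounded_in n X"
  shows "bounded_in n ((\<lambda>x. A *\<^sub>v x) ` X)"
proof -
  obtain B where X: "X \<subseteq> carrier_vec n" and B: "\<And>x i. x \<in> X \<Longrightarrow> i < n \<Longrightarrow> cmod (x $ i) \<le> B"
    using assms(2) unfolding bounded_in_iff by blast
  have "cmod ((A *\<^sub>v x) $ i) \<le> (\<Sum>i<n. \<Sum>l<n. cmod (A $$ (i, l)) * \<bar>B\<bar>)" if "x \<in> X" "i < n" for x i
  proof -
    have "(A *\<^sub>v x) $ i = (\<Sum>l<n. A $$ (i, l) * x $ l)"
      using assms(1) X that by (auto simp: scalar_prod_def lessThan_atLeast0)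
    also have "cmod \<dots> \<le> (\<Sum>l<n. cmod (A $$ (i, l)) * \<bar>B\<bar>)"
      using B[OF that(1)] by (intro sum_norm_le) (force simp: norm_mult intro!: mult_left_mono)
    also have "\<dots> \<le> (\<Sum>i<n. \<Sum>l<n. cmod (A $$ (i, l)) * \<bar>B\<bar>)"
      using that by (intro member_le_sum[of i "{..<n}"]) (auto intro!: sum_nonneg)
    finally show ?thesis .
  qed
  then have "\<forall>y \<in> (\<lambda>x. A *\<^sub>v x) ` X. \<forall>i<n. cmod (y $ i) \<le> (\<Sum>i<n. \<Sum>l<n. cmod (A $$ (i, l)) * \<bar>B\<bar>)"
    by blast
  moreover have "(\<lambda>x. A *\<^sub>v x) ` X \<subseteq> carrier_vec n"
    using X assms(1) mult_mat_vec_carrier by blast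
  ultimately show ?thesis
    unfolding bounded_in_iff by blast
qed

lemma bounded_in_layer:
  assumes "W \<in> carrier_mat n n" "b \<in> carrier_vec n" "bounded_in n X"
  shows "bounded_in n (layer W b ` X)"
proof -
  obtain B where B: "\<And>x i. x \<in> X \<Longrightarrow> i < n \<Longrightarrow> cmod ((W *\<^sub>v x) $ i) \<le> B"
    using bounded_in_mult[OF assms(1,3)] unfolding bounded_in_iff by blast
  have "cmod (layer W b x $ i) \<le> B + (\<Sum>i<n. cmod (b $ i))" if "x \<in> X" "i < n" for x i
  proof -
    have "cmod (layer W b x $ i) = cmod (crelu ((W *\<^sub>v x) $ i + b $ i) - crelu 0)"
      using assms that by (simp add: layer_def crelu_eq_self)
    also have "\<dots> \<le> cmod ((W *\<^sub>v x) $ i + b $ i - 0)" by (rule crelu_dist_le)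
    also have "\<dots> \<le> cmod ((W *\<^sub>v x) $ i) + cmod (b $ i)" by (simp add: norm_triangle_ineq)
    also have "\<dots> \<le> B + (\<Sum>i<n. cmod (b $ i))"
      using that B by (intro add_mono member_le_sum) auto
    finally show ?thesis .
  qed
  then show ?thesis unfolding bounded_in_iff using assms(1,2) by auto
qed

lemma bounded_in_dc_fun:
  assumes "is_dc_net n \<Psi>" "bounded_in n X"
  shows "bounded_in n (dc_fun \<Psi> ` X)"
proof -
  \<comment> \<open>The induction passes through the empty list, which \<open>is_dc_net\<close>
    excludes.\<close>
  have "\<forall>(D, C, c) \<in> set \<Psi>. D \<in> carrier_mat n n \<and> C \<in> carrier_mat n n \<and> c \<in> carrier_vec n"
    using assms(1) by (auto simp: is_dc_net_def)
  then show ?thesis using assms(2)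
  proof (induction \<Psi> arbitrary: X)
    case Nil
    then show ?case by (simp add: dc_fun_def)
  next
    case (Cons L \<Psi>)
    obtain D C c where L: "L = (D, C, c)" by (cases L)
    have "bounded_in n (layer (D * C) c ` X)"
      using Cons.prems by (intro bounded_in_layer) (auto simp: L)
    from Cons.IH[OF _ this] Cons.prems show ?case
      by (simp add: dc_fun_def L image_image)
  qed
qed

lemma dense_fun_carrier:
  assumes "\<forall>(W, b) \<in> set \<Omega>. W \<in> carrier_mat n n \<and> b \<in> carrier_vec n" "x \<in> carrier_vec n"
  shows "dense_fun \<Omega> x \<in> carrier_vec n"
  using assms by (induction \<Omega> arbitrary: x) (auto simp: dense_fun_def)

text \<open>A large bias in the hidden layers moves all preactivations into the region where the
  activation is the identity; the last bias undoes the accumulated shift.\<close>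

lemma dc_prod_layer:
  assumes "dc_prod n r A" "bounded_in n X" "b \<in> carrier_vec n"
  shows "\<exists>\<Psi>. is_dc_net n \<Psi> \<and> length \<Psi> = Suc r \<and> (\<forall>x\<in>X. dc_fun \<Psi> x = layer A b x)"
  using assms(1,3)
proof (induction arbitrary: b)
  case (diag D)
  \<comment> \<open>The trailing diagonal matrix is paired with the identity as circulant factor,
    which accounts for the extra layer in \<open>Suc r\<close>.\<close>
  then show ?case
    by (intro exI[of _ "[(D, 1\<^sub>m n, b)]"]) (auto simp: is_dc_net_def dc_fun_def circulant_one)
next
  case (step D C r A)
  have X: "X \<subseteq> carrier_vec n" using assms(2) by (simp add: bounded_in_def)
  have A: "A \<in> carrier_mat n n" using step.hyps dc_prod_carrier by blast
  obtain M where M: "\<And>x i. x \<in> X \<Longrightarrow> i < n \<Longrightarrow> cmod ((A *\<^sub>v x) $ i) \<le> M"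
    using bounded_in_mult[OF A assms(2)] unfolding bounded_in_iff by blast
  \<comment> \<open>A bound on the modulus bounds both parts, so this bias makes real and imaginary
    parts nonnegative.\<close>
  define s where "s = vec n (\<lambda>_. Complex M M)"
  have s: "s \<in> carrier_vec n" by (simp add: s_def)
  obtain \<Psi> where \<Psi>: "is_dc_net n \<Psi>" "length \<Psi> = Suc r" "\<And>x. x \<in> X \<Longrightarrow> dc_fun \<Psi> x = layer A s x"
    using step.IH[OF s] by blast
  have lay: "layer A s x = A *\<^sub>v x + s" if "x \<in> X" for x
  proof (rule eq_vecI)
    fix i assume "i < dim_vec (A *\<^sub>v x + s)"
    then have i: "i < n" by (simp add: s_def)
    have "\<bar>Re ((A *\<^sub>v x) $ i)\<bar> \<le> M" "\<bar>Im ((A *\<^sub>v x) $ i)\<bar> \<le> M"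
      using M[OF that i] abs_Re_le_cmod abs_Im_le_cmod order_trans by blast+
    then show "layer A s x $ i = (A *\<^sub>v x + s) $ i"
      using i A by (simp add: layer_def s_def crelu_eq_self)
  qed (simp add: layer_def)
  define c where "c = b - (D * C) *\<^sub>v s"
  have c: "c \<in> carrier_vec n" using step by (simp add: c_def s_def)
  have "dc_fun (\<Psi> @ [(D, C, c)]) x = layer (D * C * A) b x" if x: "x \<in> X" for x
  proof -
    have xc: "x \<in> carrier_vec n" using x X by blast
    have "(D * C) *\<^sub>v (A *\<^sub>v x + s) + c = (D * C * A) *\<^sub>v x + b"
    proof (rule eq_vecI)
      have DC: "D * C \<in> carrier_mat n n" using step.hyps by simp
      fix i assume "i < dim_vec ((D * C * A) *\<^sub>v x + b)"
      then have i: "i < n" using step.prems by simp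
      have "(D * C) *\<^sub>v (A *\<^sub>v x + s) = (D * C) *\<^sub>v (A *\<^sub>v x) + (D * C) *\<^sub>v s"
        using DC A xc s by (intro mult_add_distrib_mat_vec) auto
      also have "(D * C) *\<^sub>v (A *\<^sub>v x) = (D * C * A) *\<^sub>v x"
        using DC A xc by (intro assoc_mult_mat_vec[symmetric]) auto
      finally have eq: "(D * C) *\<^sub>v (A *\<^sub>v x + s) = (D * C * A) *\<^sub>v x + (D * C) *\<^sub>v s" .
      show "((D * C) *\<^sub>v (A *\<^sub>v x + s) + c) $ i = ((D * C * A) *\<^sub>v x + b) $ i"
        unfolding eq c_def using i step.prems step.hyps
        by (simp del: index_mult_mat_vec)
    qed (use step.prems c in auto)
    then show ?thesis
      using \<Psi>(3)[OF x] lay[OF x] by (simp add: dc_fun_def layer_def)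
  qed
  moreover have "is_dc_net n (\<Psi> @ [(D, C, c)])"
    using \<Psi>(1) step.hyps c by (auto simp: is_dc_net_def)
  ultimately show ?case using \<Psi>(2) by (intro exI[of _ "\<Psi> @ [(D, C, c)]"]) simp
qed

section \<open>Approximation of layers and their compositions\<close>

text \<open>Only the weight matrix is approximated; the approximating product is then realized
  exactly on \<open>X\<close> with the same bias.\<close>

lemma layer_approx:
  assumes W: "dc_approx n r W" and X: "bounded_in n X" and b: "b \<in> carrier_vec n" and "\<epsilon> > 0"
  obtains \<Psi> where "is_dc_net n \<Psi>" "length \<Psi> = Suc r"
    "\<And>x i. x \<in> X \<Longrightarrow> i < n \<Longrightarrow> cmod (layer W b x $ i - dc_fun \<Psi> x $ i) < \<epsilon>"
proof -
  obtain M where M: "\<And>x i. x \<in> X \<Longrightarrow> i < n \<Longrightarrow> cmod (x $ i) \<le> M"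
    using X unfolding bounded_in_iff by blast
  \<comment> \<open>The absolute value guards against a negative \<open>M\<close>, possible if
    \<open>X\<close> is empty or \<open>n = 0\<close>; the summand 1 keeps the denominator positive
    and the final estimate strict.\<close>
  define \<delta> where "\<delta> = \<epsilon> / (real n * \<bar>M\<bar> + 1)"
  have den: "real n * \<bar>M\<bar> + 1 > 0" by (intro add_nonneg_pos) auto
  then have \<delta>: "\<delta> > 0" using \<open>\<epsilon> > 0\<close> by (simp add: \<delta>_def)
  obtain B where B: "dc_prod n r B" "\<And>j l. j < n \<Longrightarrow> l < n \<Longrightarrow> cmod (B $$ (j, l) - W $$ (j, l)) < \<delta>"
    using W \<delta> unfolding dc_approx_def by blast
  obtain \<Psi> where \<Psi>: "is_dc_net n \<Psi>" "length \<Psi> = Suc r" "\<And>x. x \<in> X \<Longrightarrow> dc_fun \<Psi> x = layer B b x"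
    using dc_prod_layer[OF B(1) X b] by blast
  show ?thesis
  proof (rule that[OF \<Psi>(1,2)])
    fix x i assume x: "x \<in> X" and i: "i < n"
    have xc: "x \<in> carrier_vec n" using x X by (auto simp: bounded_in_def)
    have Wc: "W \<in> carrier_mat n n" using W by (simp add: dc_approx_def)
    have "cmod (layer W b x $ i - dc_fun \<Psi> x $ i)
        \<le> cmod ((\<Sum>l<n. W $$ (i, l) * x $ l) + b $ i - ((\<Sum>l<n. B $$ (i, l) * x $ l) + b $ i))"
      using crelu_dist_le
      by (simp only: \<Psi>(3)[OF x] layer_index[OF Wc b xc i] layer_index[OF dc_prod_carrier[OF B(1)] b xc i])
    also have "\<dots> = cmod (\<Sum>l<n. (W $$ (i, l) - B $$ (i, l)) * x $ l)"
      by (simp add: left_diff_distrib sum_subtractf)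
    also have "\<dots> \<le> (\<Sum>l<n. \<delta> * \<bar>M\<bar>)"
    proof (rule sum_norm_le)
      fix l assume "l \<in> {..<n}"
      then have l: "l < n" by simp
      have "cmod (W $$ (i, l) - B $$ (i, l)) \<le> \<delta>"
        using B(2)[OF i l] by (simp add: norm_minus_commute)
      moreover have "cmod (x $ l) \<le> \<bar>M\<bar>" using M[OF x l] by simp
      ultimately show "cmod ((W $$ (i, l) - B $$ (i, l)) * x $ l) \<le> \<delta> * \<bar>M\<bar>"
        using \<delta> by (simp add: norm_mult mult_mono)
    qed
    also have "\<dots> < \<delta> * (real n * \<bar>M\<bar> + 1)" using \<delta> by (simp add: algebra_simps)
    also have "\<dots> = \<epsilon>" using den by (simp add: \<delta>_def)
    finally show "cmod (layer W b x $ i - dc_fun \<Psi> x $ i) < \<epsilon>" .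
  qed
qed

text \<open>The sum of all entry moduli dominates every row sum, which gives one Lipschitz constant
  for the maximum norm.\<close>

lemma layer_lipschitz:
  assumes "W \<in> carrier_mat n n" "b \<in> carrier_vec n" "x \<in> carrier_vec n" "y \<in> carrier_vec n"
    and "i < n" "\<delta> \<ge> 0" "\<And>l. l < n \<Longrightarrow> cmod (x $ l - y $ l) \<le> \<delta>"
  shows "cmod (layer W b x $ i - layer W b y $ i) \<le> (\<Sum>i<n. \<Sum>l<n. cmod (W $$ (i, l))) * \<delta>"
proof -
  have "cmod (layer W b x $ i - layer W b y $ i)
      \<le> cmod ((\<Sum>l<n. W $$ (i, l) * x $ l) + b $ i - ((\<Sum>l<n. W $$ (i, l) * y $ l) + b $ i))"
    using assms crelu_dist_le by (simp only: layer_index)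
  also have "\<dots> = cmod (\<Sum>l<n. W $$ (i, l) * (x $ l - y $ l))"
    by (simp add: right_diff_distrib sum_subtractf)
  also have "\<dots> \<le> (\<Sum>l<n. cmod (W $$ (i, l)) * \<delta>)"
    using assms(7) by (intro sum_norm_le) (simp add: norm_mult mult_left_mono)
  also have "\<dots> = (\<Sum>l<n. cmod (W $$ (i, l))) * \<delta>" by (simp add: sum_distrib_right)
  also have "\<dots> \<le> (\<Sum>i<n. \<Sum>l<n. cmod (W $$ (i, l))) * \<delta>"
    using assms(5,6) by (intro mult_right_mono member_le_sum[of i "{..<n}"]) (auto intro!: sum_nonneg)
  finally show ?thesis .
qed

text \<open>Appending layers at the end splits the error in two: the earlier error amplified by the
  new layer, and the error of the new block. The disjunction admits the empty start of the
  induction.\<close>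

lemma dense_approx:
  assumes "\<forall>(W, b) \<in> set \<Omega>. W \<in> carrier_mat n n \<and> b \<in> carrier_vec n \<and> vec_space.rank n W \<noteq> 0"
    and n: "n = 2 ^ t" and X: "bounded_in n X" and "\<epsilon> > 0"
  shows "\<exists>\<Psi>. (is_dc_net n \<Psi> \<or> \<Psi> = [] \<and> \<Omega> = []) \<and> length \<Psi> \<le> 4 * total_rank n \<Omega> \<and>
           (\<forall>x\<in>X. \<forall>i<n. cmod (dense_fun \<Omega> x $ i - dc_fun \<Psi> x $ i) < \<epsilon>)"
  using assms(1,4)
proof (induction \<Omega> arbitrary: \<epsilon> rule: rev_induct)
  case Nil
  then show ?case by (intro exI[of _ "[]"]) (simp add: dense_fun_def dc_fun_def)
next
  case (snoc L \<Omega>)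
  obtain W b where L: "L = (W, b)" by (cases L)
  have W: "W \<in> carrier_mat n n" and b: "b \<in> carrier_vec n" and rank: "vec_space.rank n W \<noteq> 0"
    using snoc.prems(1) by (auto simp: L)
  define Lip where "Lip = (\<Sum>i<n. \<Sum>l<n. cmod (W $$ (i, l)))"
  have Lip: "Lip \<ge> 0" by (auto simp: Lip_def intro!: sum_nonneg)
  define \<delta> where "\<delta> = \<epsilon> / 2 / (Lip + 1)"
  have \<delta>: "\<delta> > 0" using Lip snoc.prems(2) by (simp add: \<delta>_def)
  obtain \<Psi> where \<Psi>: "is_dc_net n \<Psi> \<or> \<Psi> = [] \<and> \<Omega> = []" "length \<Psi> \<le> 4 * total_rank n \<Omega>"
    "\<And>x i. x \<in> X \<Longrightarrow> i < n \<Longrightarrow> cmod (dense_fun \<Omega> x $ i - dc_fun \<Psi> x $ i) < \<delta>"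
    using snoc.IH[OF _ \<delta>] snoc.prems(1) by auto
  \<comment> \<open>The new block is fitted to the outputs of the approximating network, which are
    the inputs it receives.\<close>
  have Y: "bounded_in n (dc_fun \<Psi> ` X)"
    using \<Psi>(1) X bounded_in_dc_fun by (auto simp: dc_fun_def)
  obtain r where r: "dc_approx n r W" "Suc r \<le> 4 * vec_space.rank n W"
    using dc_approx_rank[OF n W rank] by blast
  have "\<epsilon> / 2 > 0" using snoc.prems(2) by simp
  then obtain \<Phi> where \<Phi>: "is_dc_net n \<Phi>" "length \<Phi> = Suc r"
    "\<And>y i. y \<in> dc_fun \<Psi> ` X \<Longrightarrow> i < n \<Longrightarrow> cmod (layer W b y $ i - dc_fun \<Phi> y $ i) < \<epsilon> / 2"
    using layer_approx[OF r(1) Y b] by blast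
  have "cmod (dense_fun (\<Omega> @ [L]) x $ i - dc_fun (\<Psi> @ \<Phi>) x $ i) < \<epsilon>" if x: "x \<in> X" and i: "i < n" for x i
  proof -
    have u: "dense_fun \<Omega> x \<in> carrier_vec n"
      using snoc.prems(1) x X by (intro dense_fun_carrier) (auto simp: bounded_in_def)
    have v: "dc_fun \<Psi> x \<in> carrier_vec n"
      using Y x by (auto simp: bounded_in_def)
    have "cmod (layer W b (dense_fun \<Omega> x) $ i - layer W b (dc_fun \<Psi> x) $ i) \<le> Lip * \<delta>"
      unfolding Lip_def using W b u v i \<delta> \<Psi>(3)[OF x]
      by (intro layer_lipschitz) (auto intro: less_imp_le)
    also have "\<dots> \<le> \<epsilon> / 2"
    proof -
      have "Lip * \<delta> \<le> (Lip + 1) * \<delta>" using \<delta> by simp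
      also have "\<dots> = \<epsilon> / 2"
      proof -
        have "Lip + 1 \<noteq> 0" using Lip by linarith
        from iffD1[OF nonzero_eq_divide_eq[OF this] \<delta>_def] show ?thesis
          by (simp only: mult.commute)
      qed
      finally show ?thesis .
    qed
    finally have "cmod (layer W b (dense_fun \<Omega> x) $ i - layer W b (dc_fun \<Psi> x) $ i) \<le> \<epsilon> / 2" .
    moreover have "cmod (layer W b (dc_fun \<Psi> x) $ i - dc_fun \<Phi> (dc_fun \<Psi> x) $ i) < \<epsilon> / 2"
      using \<Phi>(3)[OF _ i] x by blast
    ultimately have "cmod (layer W b (dense_fun \<Omega> x) $ i - layer W b (dc_fun \<Psi> x) $ i)
        + cmod (layer W b (dc_fun \<Psi> x) $ i - dc_fun \<Phi> (dc_fun \<Psi> x) $ i) < \<epsilon>"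
      by linarith
    from norm_triangle_lt[OF this]
    have "cmod (layer W b (dense_fun \<Omega> x) $ i - dc_fun \<Phi> (dc_fun \<Psi> x) $ i) < \<epsilon>"
      by (simp only: add_diff_eq diff_add_cancel)
    then show ?thesis by (simp add: L dense_fun_def dc_fun_def)
  qed
  moreover have "is_dc_net n (\<Psi> @ \<Phi>)"
    using \<Psi>(1) \<Phi>(1) by (auto simp: is_dc_net_def)
  moreover have "length (\<Psi> @ \<Phi>) \<le> 4 * total_rank n (\<Omega> @ [L])"
    using \<Psi>(2) \<Phi>(2) r(2) by (simp add: total_rank_def L)
  ultimately show ?case by (intro exI[of _ "\<Psi> @ \<Phi>"]) auto
qed

section \<open>Networks with a layer of rank zero\<close>

lemma rank_0_imp_zero:
  fixes W :: "complex mat"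
  assumes "W \<in> carrier_mat n n" "vec_space.rank n W = 0" "j < n" "l < n"
  shows "W $$ (j, l) = 0"
proof -
  obtain U V where "\<And>j l. j < n \<Longrightarrow> l < n \<Longrightarrow> W $$ (j, l) = (\<Sum>r<(0::nat). U j r * V r l)"
    using rank_factorization[OF assms(1), of 0] assms(2) by blast
  then show ?thesis using assms(3,4) by simp
qed

lemma crelu_idem: "crelu (crelu z) = crelu z"
  by (simp add: crelu_eq_self crelu_def)

text \<open>A zero weight matrix forgets its input. The value is fixed by the activation because it
  is the output of a layer, so a single layer with bias \<open>v\<close> can reproduce it.\<close>

lemma dense_fun_const:
  assumes net: "is_dense_net n \<Omega>" and W: "(W, b) \<in> set \<Omega>" "vec_space.rank n W = 0"
  obtains v where "v \<in> carrier_vec n" "map_vec crelu v = v"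
    "\<And>x. x \<in> carrier_vec n \<Longrightarrow> dense_fun \<Omega> x = v"
proof -
  obtain \<Omega>1 \<Omega>2 where \<Omega>: "\<Omega> = \<Omega>1 @ (W, b) # \<Omega>2" using W(1) split_list by metis
  have carr: "\<forall>(W, b) \<in> set \<Omega>. W \<in> carrier_mat n n \<and> b \<in> carrier_vec n"
    using net by (simp add: is_dense_net_def)
  then have Wc: "W \<in> carrier_mat n n" and b: "b \<in> carrier_vec n" using W(1) by auto
  define v where "v = dense_fun \<Omega>2 (map_vec crelu b)"
  have v: "dense_fun \<Omega> x = v" if "x \<in> carrier_vec n" for x
  proof -
    have "dense_fun \<Omega>1 x \<in> carrier_vec n"
      using carr that by (intro dense_fun_carrier) (auto simp: \<Omega>)
    then have "layer W b (dense_fun \<Omega>1 x) = map_vec crelu b"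
    proof (intro eq_vecI)
      fix i assume "i < dim_vec (map_vec crelu b)"
      then have i: "i < n" using b by simp
      have "(\<Sum>l<n. W $$ (i, l) * dense_fun \<Omega>1 x $ l) = 0"
        using i by (simp add: rank_0_imp_zero[OF Wc W(2)])
      then show "layer W b (dense_fun \<Omega>1 x) $ i = map_vec crelu b $ i"
        using i b by (simp add: layer_index[OF Wc b \<open>dense_fun \<Omega>1 x \<in> carrier_vec n\<close> i])
    qed (simp add: layer_def)
    then show ?thesis by (simp add: \<Omega> v_def dense_fun_def)
  qed
  have "map_vec crelu (dense_fun \<Omega> x) = dense_fun \<Omega> x" for x
  proof -
    have "\<Omega> \<noteq> []" using \<Omega> by simp
    then obtain L \<Omega>' where "\<Omega> = \<Omega>' @ [L]" by (metis rev_exhaust)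
    then show ?thesis
      by (cases L) (simp add: dense_fun_def layer_def, auto simp: crelu_idem)
  qed
  from this[of "0\<^sub>v n"] have "map_vec crelu v = v" by (simp add: v)
  moreover have "v \<in> carrier_vec n"
    using dense_fun_carrier[OF carr zero_carrier_vec] by (simp add: v)
  ultimately show ?thesis using that v by blast
qed

lemma l2norm_less:
  assumes "u \<in> carrier_vec n" "v \<in> carrier_vec n" "\<epsilon> > 0"
    and "\<And>i. i < n \<Longrightarrow> cmod (u $ i - v $ i) < \<epsilon> / (real n + 1)"
  shows "l2norm (u - v) < \<epsilon>"
proof -
  have "l2norm (u - v) \<le> (\<Sum>i<n. cmod (u $ i - v $ i))"
    using L2_set_le_sum[of "{..<n}" "\<lambda>i. cmod ((u - v) $ i)"] assms(1,2) by (simp add: l2norm_def)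
  also have "\<dots> \<le> (\<Sum>i<n. \<epsilon> / (real n + 1))" using assms(4) by (intro sum_mono) (auto intro: less_imp_le)
  also have "\<dots> < \<epsilon>" using assms(3) by (simp add: field_simps)
  finally show ?thesis .
qed

theorem theorem4p4:
  fixes n p K :: nat and \<Omega> :: dense_net and X :: "complex vec set" and \<epsilon> :: real
  assumes "\<exists>k. n = 2 ^ k"
    and "is_dense_net n \<Omega>"
    and "length \<Omega> = p"
    and "total_rank n \<Omega> = K"
    and "K \<ge> 1"
    and "bounded_in n X"
    and "\<epsilon> > 0"
  shows "\<exists>\<Psi>. is_dc_net n \<Psi> \<and> length \<Psi> \<le> 5 * K \<and>
           (\<forall>x\<in>X. l2norm (dense_fun \<Omega> x - dc_fun \<Psi> x) < \<epsilon>)"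
proof -
  obtain t where n: "n = 2 ^ t" using assms(1) by blast
  have carr: "\<forall>(W, b) \<in> set \<Omega>. W \<in> carrier_mat n n \<and> b \<in> carrier_vec n"
    using assms(2) by (simp add: is_dense_net_def)
  have X: "X \<subseteq> carrier_vec n" using assms(6) by (simp add: bounded_in_def)
  have \<epsilon>: "\<epsilon> / (real n + 1) > 0" using assms(7) by simp
  show ?thesis
  \<comment> \<open>A layer of rank 0 adds nothing to the depth budget, so it cannot be replaced by
    a block of its own; the whole network is treated as a constant instead, with depth 1 covered by
    \<open>K \<ge> 1\<close>.\<close>
  proof (cases "\<exists>(W, b) \<in> set \<Omega>. vec_space.rank n W = 0")
    case True
    then obtain W b where "(W, b) \<in> set \<Omega>" "vec_space.rank n W = 0" by blast
    then obtain v where v: "v \<in> carrier_vec n" "map_vec crelu v = v"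
      "\<And>x. x \<in> carrier_vec n \<Longrightarrow> dense_fun \<Omega> x = v"
      using dense_fun_const[OF assms(2)] by blast
    let ?\<Psi> = "[(0\<^sub>m n n, 1\<^sub>m n, v)]"
    have "dc_fun ?\<Psi> x = v" if "x \<in> carrier_vec n" for x
    proof -
      have "0\<^sub>m n n *\<^sub>v x = 0\<^sub>v n"
        using that by (intro eq_vecI) (auto simp: scalar_prod_def)
      then show ?thesis using v(1,2) by (simp add: dc_fun_def layer_def)
    qed
    then have "\<forall>x\<in>X. l2norm (dense_fun \<Omega> x - dc_fun ?\<Psi> x) < \<epsilon>"
      using X v assms(7) \<epsilon> by (intro ballI l2norm_less[of _ n]) auto
    moreover have "is_dc_net n ?\<Psi>"
      using v(1) by (simp add: is_dc_net_def circulant_one diagonal_mat_def)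
    ultimately show ?thesis using assms(5) by (intro exI[of _ ?\<Psi>]) auto
  next
    case False
    then have "\<forall>(W, b) \<in> set \<Omega>. W \<in> carrier_mat n n \<and> b \<in> carrier_vec n \<and> vec_space.rank n W \<noteq> 0"
      using carr by blast
    from dense_approx[OF this n assms(6) \<epsilon>] obtain \<Psi> where
      \<Psi>: "is_dc_net n \<Psi>" "length \<Psi> \<le> 4 * K"
        "\<And>x i. x \<in> X \<Longrightarrow> i < n \<Longrightarrow> cmod (dense_fun \<Omega> x $ i - dc_fun \<Psi> x $ i) < \<epsilon> / (real n + 1)"
      using assms(2,4) by (auto simp: is_dense_net_def)
    have "l2norm (dense_fun \<Omega> x - dc_fun \<Psi> x) < \<epsilon>" if "x \<in> X" for x
    proof (rule l2norm_less[OF _ _ assms(7)])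
      show "dense_fun \<Omega> x \<in> carrier_vec n" using dense_fun_carrier[OF carr] that X by blast
      show "dc_fun \<Psi> x \<in> carrier_vec n"
        using bounded_in_dc_fun[OF \<Psi>(1) assms(6)] that by (auto simp: bounded_in_def)
    qed (use \<Psi>(3)[OF that] in blast)
    then show ?thesis using \<Psi>(1,2) by (intro exI[of _ \<Psi>]) auto
  qed
qed

end
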